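(* Let $G=U\times V$ be a finite CI-group with $\gcd(|U|,|V|)=1$, where $U$ is abelian and $V$ is one of: (1) $H_e(M,2^r3^s,l)$ for some type $e$, where $M$ is abelian, $r,s\geq0$ and $r+s\geq1$; (2) $H_2(M,2^r,l)\times H_3(M',3^s,l')$, where $|M|$, $2$, $|M'|$, $3$ are pairwise coprime, $M,M'$ are abelian, $1\leq r\leq3$, $1\leq s\leq2$ and $l,l'>1$. Then $G$ does not have the $k$-if property for any integer $k\geq2$.
   Context: Definition of $H_e(M,2^r3^s,l)$: let $M$ be a finite abelian group all of whose Sylow subgroups are homocyclic (direct products of cyclic groups of equal order), $m$ the exponent of $M$, $l$ an integer with $1\leq l\leq m$ and $\gcd(l(l-1),m)=1$, and $e$ the least positive integer with $l^e\equiv1\pmod m$. Let $r,s\geq0$ be integers such that one of the following holds: $e=2$, $r\geq1$, $s=0$, $m$ odd; $e=3$, $r=0$, $s\geq1$, $3\nmid m$; $e=4$, $r\geq2$, $s=0$, $m$ odd; $e=6$, $r\geq1$, $s\geq1$, $\gcd(m,6)=1$. Then $H_e(M,2^r3^s,l)=\langle M,z\mid z^{2^r3^s}=1,\ x^z=x^l\ \forall x\in M\rangle$ (the semidirect product $M\rtimes\langle z\rangle$), said to be of type $e$. For a finite group $G$ let $G^*=G\setminus\{1\}$. For an inverse-closed $S\subseteq G^*$, $\mathrm{Cay}(G,S)$ has vertex set $G$ and edges $\{h,g\}$ with $gh^{-1}\in S$. $G$ is a CI-group if for all inverse-closed $S,T\subseteq G^*$, $\mathrm{Cay}(G,S)\cong\mathrm{Cay}(G,T)$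 implies $T=S^{\alpha}$ for some $\alpha\in\mathrm{Aut}(G)$. A partition of a set is a collection of non-empty pairwise disjoint subsets whose union is the set. $\mathrm{Cay}(G,S)$ is a $k$-if Cayley graph if there is a partition $\{S_0=S,\dots,S_{k-1}\}$ of $G^*$ into inverse-closed subsets with $\mathrm{Cay}(G,S_i)\cong\mathrm{Cay}(G,S)$ for all $i$; $G$ has the $k$-if property if some $\mathrm{Cay}(G,S)$ is a $k$-if Cayley graph. *)

theory Defs
  imports "HOL-Algebra.Bij" "HOL-Algebra.Product_Groups" "HOL-Number_Theory.Number_Theory" "HOL-Library.Disjoint_Sets"
begin

section \<open>Cayley graphs\<close>

text \<open>A finite simple graph is a pair of a vertex set and a set of edges, each edge being the set
  of its two ends.\<close>

type_synonym 'a graph = "'a set \<times> 'a set set"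

definition graph_iso :: "'a graph \<Rightarrow> 'b graph \<Rightarrow> bool" where
  "graph_iso \<Gamma> \<Delta> \<longleftrightarrow>
     (\<exists>f. bij_betw f (fst \<Gamma>) (fst \<Delta>) \<and>
        (\<forall>u\<in>fst \<Gamma>. \<forall>v\<in>fst \<Gamma>. {u, v} \<in> snd \<Gamma> \<longleftrightarrow> {f u, f v} \<in> snd \<Delta>))"

definition nonidentity :: "('a, 'c) monoid_scheme \<Rightarrow> 'a set" where
  "nonidentity G = carrier G - {\<one>\<^bsub>G\<^esub>}"

definition inverse_closed :: "('a, 'c) monoid_scheme \<Rightarrow> 'a set \<Rightarrow> bool" where
  "inverse_closed G S \<longleftrightarrow> (\<forall>x\<in>S. inv\<^bsub>G\<^esub> x \<in> S)"

definition Cay :: "('a, 'c) monoid_scheme \<Rightarrow> 'a set \<Rightarrow> 'a graph" where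
  "Cay G S =
     (carrier G, {{h, g} | h g. h \<in> carrier G \<and> g \<in> carrier G \<and> g \<otimes>\<^bsub>G\<^esub> inv\<^bsub>G\<^esub> h \<in> S})"

definition CI_group :: "('a, 'c) monoid_scheme \<Rightarrow> bool" where
  "CI_group G \<longleftrightarrow>
     (\<forall>S T. S \<subseteq> nonidentity G \<and> inverse_closed G S \<and> T \<subseteq> nonidentity G \<and> inverse_closed G T \<and>
            graph_iso (Cay G S) (Cay G T) \<longrightarrow>
        (\<exists>\<alpha>\<in>auto G. T = \<alpha> ` S))"

definition k_if_Cayley_graph :: "('a, 'c) monoid_scheme \<Rightarrow> nat \<Rightarrow> 'a set \<Rightarrow> bool" where
  "k_if_Cayley_graph G k S \<longleftrightarrow>
     (\<exists>P. partition_on (nonidentity G) P \<and> finite P \<and> card P = k \<and> S \<in> P \<and>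
        (\<forall>T\<in>P. inverse_closed G T \<and> graph_iso (Cay G T) (Cay G S)))"

definition k_if_property :: "('a, 'c) monoid_scheme \<Rightarrow> nat \<Rightarrow> bool" where
  "k_if_property G k \<longleftrightarrow> (\<exists>S. k_if_Cayley_graph G k S)"


section \<open>Groups with homocyclic Sylow subgroups\<close>

text \<open>Exponent of a finite group. No positive exponent need exist in an infinite group, where the
  value is unspecified.\<close>

definition group_exponent :: "('a, 'c) monoid_scheme \<Rightarrow> nat" where
  "group_exponent G = (LEAST n. 0 < n \<and> (\<forall>x\<in>carrier G. x [^]\<^bsub>G\<^esub> n = \<one>\<^bsub>G\<^esub>))"

definition sylow_subgroup :: "nat \<Rightarrow> 'a set \<Rightarrow> ('a, 'c) monoid_scheme \<Rightarrow> bool" where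
  "sylow_subgroup p P G \<longleftrightarrow>
     prime p \<and> subgroup P G \<and> card P = p ^ multiplicity p (order G)"

text \<open>The positivity of \<open>n\<close> only excludes the infinite cyclic group, which is
  \<^term>\<open>integer_mod_group 0\<close>.\<close>

definition homocyclic :: "('a, 'c) monoid_scheme \<Rightarrow> bool" where
  "homocyclic G \<longleftrightarrow> (\<exists>n d. 0 < n \<and> G \<cong> product_group {..<d::nat} (\<lambda>_. integer_mod_group n))"


section \<open>The groups \<open>H_e(M, 2^r 3^s, l)\<close>\<close>

text \<open>Admissible parameters for type \<open>e\<close>. In \<open>l * (l - 1)\<close> the subtraction is the integer one,
  because \<open>1 \<le> l\<close>.\<close>

definition H_params :: "nat \<Rightarrow> ('a, 'c) monoid_scheme \<Rightarrow> nat \<Rightarrow> nat \<Rightarrow> nat \<Rightarrow> bool" where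
  "H_params e M r s l \<longleftrightarrow>
     comm_group M \<and> finite (carrier M) \<and>
     (\<forall>p P. sylow_subgroup p P M \<longrightarrow> homocyclic (M\<lparr>carrier := P\<rparr>)) \<and>
     (let m = group_exponent M in
        1 \<le> l \<and> l \<le> m \<and> coprime (l * (l - 1)) m \<and>
        e = ord m l \<and>
        (e = 2 \<and> r \<ge> 1 \<and> s = 0 \<and> odd m \<or>
         e = 3 \<and> r = 0 \<and> s \<ge> 1 \<and> \<not> 3 dvd m \<or>
         e = 4 \<and> r \<ge> 2 \<and> s = 0 \<and> odd m \<or>
         e = 6 \<and> r \<ge> 1 \<and> s \<ge> 1 \<and> gcd m 6 = 1))"

text \<open>The semidirect product of \<open>M\<close> with a cyclic group \<open>\<langle>z\<rangle>\<close> of order \<open>n\<close> in which \<open>x^z = x^l\<close>,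
  where \<open>x^z\<close> is \<open>z^{-1} x z\<close>. The pair \<open>(i, x)\<close> stands for \<open>z^i x\<close>, so that
  \<open>(z^i x)(z^j y) = z^{i+j} x^{l^j} y\<close>.\<close>

definition H_group :: "('a, 'c) monoid_scheme \<Rightarrow> nat \<Rightarrow> nat \<Rightarrow> (int \<times> 'a) monoid" where
  "H_group M n l =
     \<lparr>carrier = carrier (integer_mod_group n) \<times> carrier M,
      monoid.mult = (\<lambda>(i, x) (j, y).
        (i \<otimes>\<^bsub>integer_mod_group n\<^esub> j, (x [^]\<^bsub>M\<^esub> (l ^ nat j)) \<otimes>\<^bsub>M\<^esub> y)),
      one = (\<one>\<^bsub>integer_mod_group n\<^esub>, \<one>\<^bsub>M\<^esub>)\<rparr>"

lemma group_exponent_pow: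
  assumes "group M" "finite (carrier M)"
  shows "0 < group_exponent M" "x \<in> carrier M \<Longrightarrow> x [^]\<^bsub>M\<^esub> group_exponent M = \<one>\<^bsub>M\<^esub>"
proof -
  interpret group M by fact
  have "0 < order M \<and> (\<forall>x\<in>carrier M. x [^]\<^bsub>M\<^esub> order M = \<one>\<^bsub>M\<^esub>)"
    using pow_order_eq_1 assms(2) order_gt_0_iff_finite by auto
  hence *: "0 < group_exponent M \<and> (\<forall>x\<in>carrier M. x [^]\<^bsub>M\<^esub> group_exponent M = \<one>\<^bsub>M\<^esub>)"
    unfolding group_exponent_def by (rule LeastI)
  show "0 < group_exponent M" "x \<in> carrier M \<Longrightarrow> x [^]\<^bsub>M\<^esub> group_exponent M = \<one>\<^bsub>M\<^esub>"
    using * by auto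
qed

lemma H_params_pow:
  assumes H: "H_params e M r s l"
  shows "[l ^ (2 ^ r * 3 ^ s) = 1] (mod group_exponent M)"
proof -
  have e: "[l ^ e = 1] (mod group_exponent M)"
    using H ord[of l "group_exponent M"] by (auto simp: H_params_def Let_def)
  have "e dvd 2 ^ r * 3 ^ s"
  proof -
    have "(4::nat) dvd 2 ^ r" if "r \<ge> 2"
      using le_imp_power_dvd[OF that, of "2::nat"] by simp
    moreover have "(2::nat) * 3 dvd 2 ^ r * 3 ^ s" if "r \<ge> 1" "s \<ge> 1"
      using le_imp_power_dvd[OF that(1), of "2::nat"] le_imp_power_dvd[OF that(2), of "3::nat"]
      by (intro mult_dvd_mono) auto
    ultimately show ?thesis
      using H by (auto simp: H_params_def Let_def)
  qed
  then obtain q where "2 ^ r * 3 ^ s = e * q" ..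
  thus ?thesis using cong_pow[OF e, of q] by (simp add: power_mult)
qed

lemma pow_cong_exponent:
  assumes "group M" "finite (carrier M)" "x \<in> carrier M" "[a = b] (mod group_exponent M)"
  shows "x [^]\<^bsub>M\<^esub> a = x [^]\<^bsub>M\<^esub> b"
proof -
  interpret group M by fact
  have *: "x [^]\<^bsub>M\<^esub> c = x [^]\<^bsub>M\<^esub> (c mod group_exponent M)" for c :: nat
  proof -
    have "x [^]\<^bsub>M\<^esub> c =
        x [^]\<^bsub>M\<^esub> (group_exponent M * (c div group_exponent M) + c mod group_exponent M)"
      by simp
    also have "\<dots> = x [^]\<^bsub>M\<^esub> (c mod group_exponent M)"
      using assms group_exponent_pow(2)[OF assms(1,2,3)]
      by (simp only: nat_pow_mult [symmetric] nat_pow_pow [symmetric] nat_pow_one l_one nat_pow_closed)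
    finally show ?thesis .
  qed
  show ?thesis using *[of a] *[of b] assms(4) by (simp add: cong_def)
qed

lemma group_H_group:
  assumes H: "H_params e M r s l"
  shows "group (H_group M (2 ^ r * 3 ^ s) l)"
proof -
  define n :: nat where "n = 2 ^ r * 3 ^ s"
  have n: "0 < n" by (simp add: n_def)
  interpret M: comm_group M using H by (simp add: H_params_def)
  have fin: "finite (carrier M)" using H by (simp add: H_params_def)
  have ln: "[l ^ n = 1] (mod group_exponent M)"
    using H_params_pow[OF H] by (simp add: n_def)
  have lmod: "[l ^ (c mod n) = l ^ c] (mod group_exponent M)" for c
  proof -
    have "l ^ c = (l ^ n) ^ (c div n) * l ^ (c mod n)"
      by (simp flip: power_mult power_add)
    moreover have "[(l ^ n) ^ (c div n) * l ^ (c mod n) = 1 ^ (c div n) * l ^ (c mod n)]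
        (mod group_exponent M)"
      by (intro cong_mult cong_pow ln) auto
    ultimately show ?thesis by (simp add: cong_sym)
  qed
  have act: "x [^]\<^bsub>M\<^esub> (l ^ nat ((i + j) mod int n)) = (x [^]\<^bsub>M\<^esub> (l ^ nat i)) [^]\<^bsub>M\<^esub> (l ^ nat j)"
    if "x \<in> carrier M" "0 \<le> i" "0 \<le> j" for x i j
  proof -
    have "nat ((i + j) mod int n) = (nat i + nat j) mod n"
      using that by (simp add: nat_mod_distrib nat_add_distrib)
    thus ?thesis
      using pow_cong_exponent[OF M.is_group fin that(1) lmod, of "nat i + nat j"] that
      by (simp add: M.nat_pow_pow power_add)
  qed
  have "group (H_group M n l)"
  proof (rule groupI, goal_cases)
    case (1 x y)
    thus ?case using n by (auto simp: H_group_def carrier_integer_mod_group)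
  next
    case 2
    show ?case using n by (auto simp: H_group_def carrier_integer_mod_group)
  next
    case (3 x y z)
    thus ?case using n
      by (auto simp: H_group_def carrier_integer_mod_group act M.m_assoc
          M.nat_pow_distrib mod_add_left_eq mod_add_right_eq add.assoc)
  next
    case (4 x)
    thus ?case using n by (auto simp: H_group_def carrier_integer_mod_group)
  next
    case (5 a)
    then obtain i x where a: "a = (i, x)" "0 \<le> i" "i < int n" "x \<in> carrier M"
      using n by (auto simp: H_group_def carrier_integer_mod_group)
    let ?j = "(- i) mod int n"
    let ?y = "inv\<^bsub>M\<^esub> (x [^]\<^bsub>M\<^esub> (l ^ nat ?j))"
    have "nat (((?j + i) mod int n)) = 0" by (simp add: mod_add_left_eq)
    hence "(x [^]\<^bsub>M\<^esub> (l ^ nat ?j)) [^]\<^bsub>M\<^esub> (l ^ nat i) = x"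
      using act[of x ?j i] a n by simp
    hence "?y [^]\<^bsub>M\<^esub> (l ^ nat i) \<otimes>\<^bsub>M\<^esub> x = \<one>\<^bsub>M\<^esub>"
      using a by (simp add: M.nat_pow_inv)
    thus ?case using a n
      by (intro bexI[of _ "(?j, ?y)"])
         (auto simp: H_group_def carrier_integer_mod_group mod_add_left_eq)
  qed
  thus ?thesis by (simp add: n_def)
qed

text \<open>The defining relation \<open>x z = z x^l\<close>.\<close>

lemma H_group_relation:
  assumes "comm_group M" "1 < n" "x \<in> carrier M"
  shows "(0, x) \<otimes>\<^bsub>H_group M n l\<^esub> (1, \<one>\<^bsub>M\<^esub>) =
         (1, \<one>\<^bsub>M\<^esub>) \<otimes>\<^bsub>H_group M n l\<^esub> (0, x [^]\<^bsub>M\<^esub> l)"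
proof -
  interpret comm_group M by fact
  show ?thesis using assms by (simp add: H_group_def)
qed

end

theory Submission
  imports Defs "HOL-Algebra.Sylow"
begin

text \<open>In a CI-group the parts of a \<open>k\<close>-if partition are images of each other under automorphisms, so
  each of them contains the same number of elements of any class defined by element orders. Hence
  \<open>k\<close> divides the size of such a class, and so does \<open>2k\<close> if the class contains no involution,
  because the parts are inverse-closed.

  Let \<open>G = W \<times> H_e(M, n, l)\<close> with coprime factors, where \<open>n = 2^r 3^s\<close>. If \<open>n = e\<close>, the
  nontrivial elements of \<open>M\<close> and the elements \<open>z^i x\<close> with \<open>i\<close> prime to \<open>n\<close> form such classes, of
  sizes \<open>|M| - 1\<close> and \<open>\<phi>(n) |M|\<close>. Since \<open>\<phi>(2) = 1\<close> and \<open>\<phi>(3) = \<phi>(4) = \<phi>(6) = 2\<close>, \<open>k\<close> divides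
  both \<open>|M| - 1\<close> and \<open>|M|\<close>. Otherwise \<open>e\<close> divides \<open>n / p\<close> for \<open>p = 2\<close> or \<open>p = 3\<close>, and only
  \<open>p - 1\<close> elements have order \<open>p\<close>, all of them central powers of \<open>z\<close>. In the case of two factors
  one takes \<open>W = U \<times> H_3(M', 3^s, l')\<close>.\<close>

section \<open>Element orders under isomorphisms and in coprime direct products\<close>

lemma ord_iso:
  assumes "group G" "group H" "f \<in> iso G H" "x \<in> carrier G"
  shows "group.ord H (f x) = group.ord G x"
proof -
  interpret G: group G by fact
  interpret H: group H by fact
  have hom: "f \<in> hom G H" and inj: "inj_on f (carrier G)" and fx: "f x \<in> carrier H"
    using assms by (auto simp: iso_iff)
  have "f x [^]\<^bsub>H\<^esub> n = \<one>\<^bsub>H\<^esub> \<longleftrightarrow> x [^]\<^bsub>G\<^esub> n = \<one>\<^bsub>G\<^esub>" for n :: nat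
    using hom_nat_pow[OF hom assms(4) assms(1,2), of n] inj assms(4)
      hom_one[OF hom assms(1,2)]
    by (metis G.nat_pow_closed G.one_closed inj_onD)
  thus ?thesis
    using H.ord_unique[OF fx] G.pow_eq_id[OF assms(4)] by metis
qed

lemma bij_betw_ord_class:
  assumes "group G" "group H" "f \<in> iso G H"
  shows "bij_betw f {x \<in> carrier G. group.ord G x \<in> A} {y \<in> carrier H. group.ord H y \<in> A}"
proof (rule bij_betw_subset)
  show bij: "bij_betw f (carrier G) (carrier H)" using assms(3) by (simp add: iso_def)
  show "f ` {x \<in> carrier G. group.ord G x \<in> A} = {y \<in> carrier H. group.ord H y \<in> A}"
    unfolding bij_betw_imp_surj_on[OF bij, symmetric] using ord_iso[OF assms] by auto
qed auto

lemma card_ord_class_iso: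
  assumes "group G" "group H" "G \<cong> H"
  shows "card {x \<in> carrier G. group.ord G x \<in> A} = card {y \<in> carrier H. group.ord H y \<in> A}"
  using bij_betw_ord_class[OF assms(1,2)] assms(3) bij_betw_same_card
  unfolding is_iso_def by blast

lemma nat_pow_DirProd:
  fixes n :: nat
  assumes "group G" "group H" "x \<in> carrier G" "y \<in> carrier H"
  shows "(x, y) [^]\<^bsub>G \<times>\<times> H\<^esub> n = (x [^]\<^bsub>G\<^esub> n, y [^]\<^bsub>H\<^esub> n)"
proof -
  interpret G: group G by fact
  interpret H: group H by fact
  interpret GH: group "G \<times>\<times> H" using assms by (simp add: DirProd_group)
  show ?thesis by (induction n) auto
qed

text \<open>If the order of \<open>(x, y)\<close> divides \<open>order H\<close>, then the order of
  \<open>x\<close> divides both \<open>order W\<close> and \<open>order H\<close>, so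
  \<open>x\<close> is trivial. The class thus lies in the copy of \<open>H\<close>, where orders are
  unchanged.\<close>

lemma card_ord_class_coprime_factor:
  assumes W: "group W" "finite (carrier W)" and H: "group H"
    and cop: "coprime (order W) (order H)"
    and A: "\<And>d. d \<in> A \<Longrightarrow> d dvd order H"
  shows "card {x \<in> carrier (W \<times>\<times> H). group.ord (W \<times>\<times> H) x \<in> A} =
    card {y \<in> carrier H. group.ord H y \<in> A}"
proof -
  interpret W: group W by fact
  interpret H: group H by fact
  interpret WH: group "W \<times>\<times> H" using assms by (simp add: DirProd_group)
  have ord1: "WH.ord (\<one>\<^bsub>W\<^esub>, y) = H.ord y" if "y \<in> carrier H" for y
    using that by (subst WH.ord_unique) (auto simp: nat_pow_DirProd W H H.pow_eq_id)
  have one: "x = \<one>\<^bsub>W\<^esub>" if "x \<in> carrier W" "y \<in> carrier H" "WH.ord (x, y) \<in> A" for x y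
  proof -
    have "(x, y) [^]\<^bsub>W \<times>\<times> H\<^esub> order H = \<one>\<^bsub>W \<times>\<times> H\<^esub>"
      using A[OF that(3)] that by (subst WH.pow_eq_id) auto
    hence "x [^]\<^bsub>W\<^esub> order H = \<one>\<^bsub>W\<^esub>"
      using that by (simp add: nat_pow_DirProd W H)
    hence "W.ord x dvd order H" "W.ord x dvd order W"
      using W.pow_eq_id W.ord_dvd_group_order that by auto
    with cop have "W.ord x dvd 1" by (meson coprime_def)
    thus ?thesis using W.ord_eq_1 that by simp
  qed
  have "{x \<in> carrier (W \<times>\<times> H). WH.ord x \<in> A} = Pair \<one>\<^bsub>W\<^esub> ` {y \<in> carrier H. H.ord y \<in> A}"
  proof (intro equalityI subsetI)
    fix z assume "z \<in> {x \<in> carrier (W \<times>\<times> H). WH.ord x \<in> A}"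
    then obtain x y where "z = (x, y)" "x \<in> carrier W" "y \<in> carrier H" "WH.ord (x, y) \<in> A" by auto
    with one[of x y] ord1[of y] show "z \<in> Pair \<one>\<^bsub>W\<^esub> ` {y \<in> carrier H. H.ord y \<in> A}" by auto
  qed (auto simp: ord1)
  thus ?thesis by (simp add: card_image inj_on_def)
qed

section \<open>Counting order classes across a partition\<close>

text \<open>The set splits into pairs of an element and its inverse.\<close>

lemma even_card_inverse_closed:
  assumes G: "group G" and fin: "finite X" and X: "X \<subseteq> carrier G"
    and inv: "inverse_closed G X" and no: "\<And>x. x \<in> X \<Longrightarrow> inv\<^bsub>G\<^esub> x \<noteq> x"
  shows "even (card X)"
proof -
  interpret group G by fact
  let ?P = "(\<lambda>x. {x, inv\<^bsub>G\<^esub> x}) ` X"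
  have "card (\<Union>?P) = sum card ?P"
  proof (rule card_Union_disjoint)
    show "disjoint ?P"
    proof (rule disjointI)
      fix a b assume "a \<in> ?P" "b \<in> ?P" "a \<noteq> b"
      then obtain x y where xy: "x \<in> X" "y \<in> X" "a = {x, inv\<^bsub>G\<^esub> x}" "b = {y, inv\<^bsub>G\<^esub> y}" by auto
      hence inv_inv: "inv\<^bsub>G\<^esub> (inv\<^bsub>G\<^esub> x) = x" "inv\<^bsub>G\<^esub> (inv\<^bsub>G\<^esub> y) = y" using X by auto
      show "a \<inter> b = {}"
      proof (rule ccontr)
        assume "a \<inter> b \<noteq> {}"
        then consider "x = y" | "x = inv\<^bsub>G\<^esub> y" | "inv\<^bsub>G\<^esub> x = y" | "inv\<^bsub>G\<^esub> x = inv\<^bsub>G\<^esub> y"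
          unfolding xy by blast
        hence "x = y \<or> x = inv\<^bsub>G\<^esub> y"
          using inv_inv by cases metis+
        thus False using \<open>a \<noteq> b\<close> inv_inv(2) unfolding xy by (auto simp: insert_commute)
      qed
    qed
  qed auto
  also have "\<dots> = (\<Sum>a\<in>?P. 2)"
  proof (rule sum.cong)
    have "card {x, inv\<^bsub>G\<^esub> x} = 2" if "x \<in> X" for x
      using no[OF that] by simp
    thus "card a = 2" if "a \<in> ?P" for a using that by blast
  qed simp
  also have "\<Union>?P = X" using inv by (auto simp: inverse_closed_def)
  finally show ?thesis by simp
qed

text \<open>The CI property turns isomorphic parts into images under automorphisms, which preserve
  orders, so all parts meet the class equally often. If 2 is excluded as well, no member of the
  class is its own inverse and each intersection has even size.\<close>

lemma k_if_card_ord_class: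
  assumes G: "group G" "finite (carrier G)" "CI_group G"
    and k: "k_if_property G k" and A: "1 \<notin> A"
  shows "k dvd card {x \<in> carrier G. group.ord G x \<in> A}"
    and "2 \<notin> A \<Longrightarrow> 2 * k dvd card {x \<in> carrier G. group.ord G x \<in> A}"
proof -
  interpret group G by fact
  define X where "X = {x \<in> carrier G. ord x \<in> A}"
  obtain S P where P: "partition_on (nonidentity G) P" "finite P" "card P = k" "S \<in> P"
      "\<And>T. T \<in> P \<Longrightarrow> inverse_closed G T \<and> graph_iso (Cay G T) (Cay G S)"
    using k unfolding k_if_property_def k_if_Cayley_graph_def by blast
  have sub: "T \<subseteq> nonidentity G" if "T \<in> P" for T
    using P(1) that by (auto simp: partition_on_def)
  have XI: "X \<subseteq> nonidentity G" using A ord_eq_1 by (auto simp: X_def nonidentity_def)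
  have finX: "finite X" using G(2) by (simp add: X_def)
  have card_eq: "card (X \<inter> T) = card (X \<inter> S)" if TP: "T \<in> P" for T
  proof -
    obtain \<alpha> where \<alpha>: "\<alpha> \<in> auto G" "S = \<alpha> ` T"
      using G(3)[unfolded CI_group_def, rule_format, of T S] sub[OF TP] sub[OF P(4)]
        P(5)[OF TP] P(5)[OF P(4)] by blast
    have iso: "\<alpha> \<in> iso G G" using \<alpha>(1) by (auto simp: auto_def iso_def Bij_def)
    have T: "T \<subseteq> carrier G" using sub[OF TP] by (auto simp: nonidentity_def)
    have "\<alpha> ` (X \<inter> T) = X \<inter> S"
      using ord_iso[OF G(1) G(1) iso] T iso \<alpha>(2) by (auto simp: X_def iso_iff)
    moreover have "inj_on \<alpha> (X \<inter> T)"
      using iso T by (auto simp: iso_iff intro: inj_on_subset)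
    ultimately show ?thesis using card_image by metis
  qed
  \<comment> \<open>The parts cover the class because \<open>1 \<notin> A\<close> keeps the identity
    out of it.\<close>
  have "X = (\<Union>T\<in>P. X \<inter> T)" using P(1) XI by (auto simp: partition_on_def)
  also have "card \<dots> = (\<Sum>T\<in>P. card (X \<inter> T))"
    using P(1,2) finX
    by (intro card_UN_disjoint) (auto simp: partition_on_def disjoint_def)
  also have "\<dots> = k * card (X \<inter> S)" using card_eq P(3) by simp
  finally have card: "card X = k * card (X \<inter> S)" .
  show "k dvd card {x \<in> carrier G. ord x \<in> A}" using card by (simp add: X_def)
  assume 2: "2 \<notin> A"
  have "even (card (X \<inter> S))"
  proof (rule even_card_inverse_closed[OF G(1)])
    show "X \<inter> S \<subseteq> carrier G" "finite (X \<inter> S)" using finX by (auto simp: X_def)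
    show "inverse_closed G (X \<inter> S)"
      using P(4,5) by (auto simp: inverse_closed_def X_def ord_inv)
    fix x assume x: "x \<in> X \<inter> S"
    show "inv\<^bsub>G\<^esub> x \<noteq> x"
    proof
      assume "inv\<^bsub>G\<^esub> x = x"
      hence "x [^]\<^bsub>G\<^esub> (2::nat) = \<one>\<^bsub>G\<^esub>" using x by (metis IntD1 X_def mem_Collect_eq l_inv nat_pow_Suc
            numeral_2_eq_2 nat_pow_0 l_one)
      hence "ord x dvd 2" using x pow_eq_id by (auto simp: X_def)
      hence "ord x = 1 \<or> ord x = 2" using prime_nat_iff two_is_prime_nat by blast
      with x A 2 show False by (auto simp: X_def)
    qed
  qed
  thus "2 * k dvd card {x \<in> carrier G. ord x \<in> A}" using card by (simp add: X_def mult.commute mult_dvd_mono)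
qed

text \<open>This moves the count from \<open>G\<close> to the factor \<open>H\<close>, where
  elements are explicit.\<close>

lemma k_if_card_ord_class_factor:
  assumes G: "group G" "finite (carrier G)" "CI_group G" "k_if_property G k"
    and W: "group W" "finite (carrier W)" and H: "group H" and iso: "G \<cong> W \<times>\<times> H"
    and cop: "coprime (order W) (order H)"
    and A: "\<And>d. d \<in> A \<Longrightarrow> d dvd order H" "1 \<notin> A"
  shows "k dvd card {x \<in> carrier H. group.ord H x \<in> A}"
    and "2 \<notin> A \<Longrightarrow> 2 * k dvd card {x \<in> carrier H. group.ord H x \<in> A}"
  using k_if_card_ord_class[OF G A(2)] DirProd_group[OF W(1) H]
    card_ord_class_iso[OF G(1) _ iso, of A] card_ord_class_coprime_factor[OF W H cop A(1)]
  by simp_all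

section \<open>Cauchy's theorem and element orders in the semidirect product\<close>

text \<open>Cauchy's theorem: \<open>sylow_thm\<close> with exponent 1 yields a subgroup of order
  \<open>p\<close>, and any nontrivial element of it has order \<open>p\<close>.\<close>

lemma exists_ord_prime:
  assumes "group G" "finite (carrier G)" "prime p" "p dvd order G"
  shows "\<exists>x\<in>carrier G. group.ord G x = p"
proof -
  interpret group G by fact
  obtain H where H: "subgroup H G" "card H = p"
    using sylow_thm[OF assms(3,1), of 1 "order G div p"] assms(2,4)
    by (metis dvd_mult_div_cancel power_one_right)
  have "card H > 1" using H(2) prime_gt_1_nat[OF assms(3)] by simp
  then obtain x where x: "x \<in> H" "x \<noteq> \<one>\<^bsub>G\<^esub>"
    using card_mono[of "{\<one>\<^bsub>G\<^esub>}" H] by fastforce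
  have xG: "x \<in> carrier G" using H(1) x subgroup.mem_carrier by fastforce
  interpret GH: group "G\<lparr>carrier := H\<rparr>" using H(1) subgroup_imp_group by blast
  have "x [^]\<^bsub>G\<lparr>carrier := H\<rparr>\<^esub> p = \<one>\<^bsub>G\<^esub>"
    using GH.pow_order_eq_1[of x] H x by (simp add: order_def)
  hence "x [^]\<^bsub>G\<^esub> p = \<one>\<^bsub>G\<^esub>" by (simp add: nat_pow_consistent[symmetric])
  hence "ord x dvd p" "ord x \<noteq> 1" using xG x pow_eq_id ord_eq_1 by auto
  thus ?thesis using assms(3) xG prime_nat_iff by blast
qed

text \<open>The counts rest on coprimality of the two factors; a congruence on \<open>l\<close> is
  assumed only in the lemmas that use one.\<close>

locale coprime_H_group =
  fixes M :: "('a, 'c) monoid_scheme" and n l :: nat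
  assumes M: "comm_group M" "finite (carrier M)" and H: "group (H_group M n l)"
    and n: "0 < n" and coprime_n: "coprime n (order M)"
begin

sublocale M: comm_group M by (rule M(1))
sublocale H: group "H_group M n l" by (rule H)

abbreviation "K \<equiv> H_group M n l"

lemma carrier_H: "carrier K = {0..<int n} \<times> carrier M"
  using n by (simp add: H_group_def carrier_integer_mod_group)

lemma order_H: "order K = n * order M"
  by (simp add: order_def carrier_H card_cartesian_product)

lemma one_H: "\<one>\<^bsub>K\<^esub> = (0, \<one>\<^bsub>M\<^esub>)"
  by (simp add: H_group_def)

lemma pow_fst: "h \<in> carrier K \<Longrightarrow> fst (h [^]\<^bsub>K\<^esub> c) = int c * fst h mod int n"
proof (induction c)
  case (Suc c)
  have "fst (g \<otimes>\<^bsub>K\<^esub> h) = (fst g + fst h) mod int n" for g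
    by (simp add: H_group_def split: prod.split)
  with Suc show ?case by (simp add: mod_simps distrib_right add.commute)
qed (simp add: one_H)

text \<open>Here \<open>z^i\<close> centralises \<open>M\<close>, so the second coordinate
  multiplies as in \<open>M\<close>.\<close>

lemma pow_snd:
  assumes "(i, x) \<in> carrier K" "[l ^ nat i = 1] (mod group_exponent M)"
  shows "snd ((i, x) [^]\<^bsub>K\<^esub> c) = x [^]\<^bsub>M\<^esub> (c :: nat)"
proof (induction c)
  case (Suc c)
  have "(i, x) [^]\<^bsub>K\<^esub> c \<in> carrier K" using assms by (intro H.nat_pow_closed)
  moreover have "y [^]\<^bsub>M\<^esub> (l ^ nat i) = y" if "y \<in> carrier M" for y
    using pow_cong_exponent[OF M.is_group M(2) that assms(2)] that by simp
  ultimately show ?case using Suc assms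
    by (cases "(i, x) [^]\<^bsub>K\<^esub> c") (auto simp: H_group_def)
qed (simp add: H_group_def)

text \<open>This translates order conditions into conditions on the exponent of \<open>z\<close>:
  \<open>h^c\<close> is killed by \<open>order M\<close> exactly when it lies in \<open>M\<close>.
  One direction is Lagrange in \<open>M\<close>; the other cancels \<open>order M\<close>, which is
  coprime to \<open>n\<close>.\<close>

lemma ord_dvd_times_order:
  assumes "h \<in> carrier K"
  shows "H.ord h dvd c * order M \<longleftrightarrow> int n dvd int c * fst h"
proof -
  have closed: "h [^]\<^bsub>K\<^esub> c \<in> carrier K" using assms by simp
  have pow: "h [^]\<^bsub>K\<^esub> (c * order M) = (h [^]\<^bsub>K\<^esub> c) [^]\<^bsub>K\<^esub> order M"
    using assms by (simp add: H.nat_pow_pow)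
  have cop: "coprime (int n) (int (order M))" using coprime_n by simp
  show ?thesis
  proof
    assume "H.ord h dvd c * order M"
    hence "h [^]\<^bsub>K\<^esub> (c * order M) = \<one>\<^bsub>K\<^esub>" using assms H.pow_eq_id by blast
    hence "int (c * order M) * fst h mod int n = 0"
      using pow_fst[OF assms, of "c * order M"] by (simp add: one_H)
    hence "int n dvd (int c * fst h) * int (order M)"
      by (simp add: mod_0_imp_dvd ac_simps)
    thus "int n dvd int c * fst h" using cop coprime_dvd_mult_left_iff by blast
  next
    assume "int n dvd int c * fst h"
    hence f0: "fst (h [^]\<^bsub>K\<^esub> c) = 0" using pow_fst[OF assms, of c] by simp
    then obtain y where y: "h [^]\<^bsub>K\<^esub> c = (0, y)" by (metis prod.collapse)
    have yK: "(0, y) \<in> carrier K" using closed y by simp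
    hence yM: "y \<in> carrier M" by (simp add: carrier_H)
    have "(0, y) [^]\<^bsub>K\<^esub> order M = \<one>\<^bsub>K\<^esub>"
      using pow_fst[OF yK, of "order M"] pow_snd[OF yK, of "order M"] M.pow_order_eq_1[OF yM]
      by (simp add: one_H prod_eq_iff)
    thus "H.ord h dvd c * order M" using y pow H.pow_eq_id[OF assms] by simp
  qed
qed

text \<open>By coprimality this order class is \<open>M\<close> without the identity.\<close>

lemma card_ord_dvd_order:
  "card {h \<in> carrier K. H.ord h \<in> {d. d dvd order M \<and> d \<noteq> 1}} = order M - 1"
proof -
  have "{h \<in> carrier K. H.ord h \<in> {d. d dvd order M \<and> d \<noteq> 1}} = {0} \<times> carrier M - {(0, \<one>\<^bsub>M\<^esub>)}"
    (is "?L = ?R")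
  proof -
    have "h \<in> ?L \<longleftrightarrow> h \<in> ?R" for h
    proof -
      have "h \<in> ?L \<longleftrightarrow> h \<in> carrier K \<and> int n dvd fst h \<and> h \<noteq> \<one>\<^bsub>K\<^esub>"
        using ord_dvd_times_order[of h 1] H.ord_eq_1[of h] by auto
      moreover have "int n dvd i \<longleftrightarrow> i = 0" if "0 \<le> i" "i < int n" for i
        using that zdvd_imp_le[of "int n" i] by force
      ultimately show ?thesis using n by (auto simp: carrier_H one_H)
    qed
    thus ?thesis by blast
  qed
  thus ?thesis using M(2) by (simp add: order_def card_cartesian_product card_Diff_singleton)
qed

text \<open>The condition on \<open>i\<close> says that \<open>z^i\<close> generates the complement,
  and it leaves the \<open>M\<close>-coordinate free. Phrasing it by divisibility of orders makes
  the set an order class.\<close>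

lemma card_ord_outside:
  "card {h \<in> carrier K. H.ord h \<in> {d. d dvd n * order M \<and> (\<forall>c\<in>{0<..<n}. \<not> d dvd c * order M)}} =
    card {i \<in> {0..<int n}. \<forall>c\<in>{0<..<n}. \<not> int n dvd int c * i} * order M"
proof -
  have "{h \<in> carrier K. H.ord h \<in> {d. d dvd n * order M \<and> (\<forall>c\<in>{0<..<n}. \<not> d dvd c * order M)}} =
    {i \<in> {0..<int n}. \<forall>c\<in>{0<..<n}. \<not> int n dvd int c * i} \<times> carrier M"
    by (auto simp: ord_dvd_times_order carrier_H)
  thus ?thesis by (simp add: order_def card_cartesian_product)
qed

text \<open>If the subgroup of order \<open>p\<close> of the complement centralises \<open>M\<close>, then it
  contains all elements of order \<open>p\<close>.\<close>

lemma card_ord_prime: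
  assumes p: "prime p" and nq: "n = p * q" and q: "[l ^ q = 1] (mod group_exponent M)"
  shows "0 < card {h \<in> carrier K. H.ord h \<in> {p}}" "card {h \<in> carrier K. H.ord h \<in> {p}} < p"
proof -
  have q0: "q > 0" and p1: "p > 1" using n nq p prime_gt_1_nat by (auto simp: gr0I)
  let ?X = "{h \<in> carrier K. H.ord h \<in> {p}}"
  have lq: "[l ^ nat (int q * j) = 1] (mod group_exponent M)" if "0 \<le> j" for j
  proof -
    have "nat (int q * j) = q * nat j" using that by (simp add: nat_mult_distrib)
    thus ?thesis using cong_pow[OF q, of "nat j"] by (simp add: power_mult)
  qed
  have sub: "?X \<subseteq> (\<lambda>j. (int q * j, \<one>\<^bsub>M\<^esub>)) ` {1..<int p}"
  proof
    fix h assume h: "h \<in> ?X"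
    obtain i x where ix: "h = (i, x)" by fastforce
    have hK: "h \<in> carrier K" and xM: "x \<in> carrier M" and i: "0 \<le> i" "i < int n"
      using h by (auto simp: ix carrier_H)
    have pow: "h [^]\<^bsub>K\<^esub> p = \<one>\<^bsub>K\<^esub>" using H.pow_ord_eq_1[OF hK] h by auto
    hence "int p * i mod int n = 0" using pow_fst[OF hK, of p] by (simp add: ix one_H)
    hence "int n dvd int p * i" by (rule mod_0_imp_dvd)
    \<comment> \<open>So \<open>z^i\<close> is a power of \<open>z^q\<close>, which centralises
      \<open>M\<close>, and powers of \<open>h\<close> can be computed coordinatewise.\<close>
    hence "int q dvd i" using p1 by (simp add: nq)
    then obtain j where j: "i = int q * j" ..
    have j0: "0 \<le> j" using i(1) j q0 by (simp add: zero_le_mult_iff)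
    have "int q * j < int q * int p" using i(2) j nq by (simp add: mult.commute)
    hence jp: "j < int p" using q0 by simp
    have "x [^]\<^bsub>M\<^esub> p = \<one>\<^bsub>M\<^esub>"
      using pow_snd[of i x p] lq[OF j0] pow hK by (simp add: ix j one_H)
    hence "M.ord x dvd p" "M.ord x dvd order M"
      using M.pow_eq_id M.ord_dvd_group_order xM by auto
    moreover have "coprime p (order M)" using coprime_n nq by simp
    ultimately have "M.ord x dvd 1" by (meson coprime_def)
    hence x1: "x = \<one>\<^bsub>M\<^esub>" using M.ord_eq_1 xM by simp
    have "j \<noteq> 0"
    proof
      assume "j = 0"
      hence "h = \<one>\<^bsub>K\<^esub>" by (simp add: ix x1 j one_H)
      hence "H.ord h = 1" by simp
      with h p1 show False by auto
    qed
    with j0 jp show "h \<in> (\<lambda>j. (int q * j, \<one>\<^bsub>M\<^esub>)) ` {1..<int p}"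
      by (auto simp: ix x1 j)
  qed
  have "card ?X \<le> card ((\<lambda>j. (int q * j, \<one>\<^bsub>M\<^esub>)) ` {1..<int p})"
    by (rule card_mono[OF _ sub]) simp
  also have "\<dots> \<le> card {1..<int p}" by (rule card_image_le) simp
  also have "\<dots> < p" using p1 by simp
  finally show "card ?X < p" .
  have fin: "finite (carrier K)" using M(2) by (simp add: carrier_H)
  have "p dvd order K" unfolding order_H by (simp add: nq)
  \<comment> \<open>Cauchy's theorem supplies the lower bound.\<close>
  then have "?X \<noteq> {}" using exists_ord_prime[OF H fin p] by auto
  with fin show "0 < card ?X" by (simp add: card_gt_0_iff)
qed

end

section \<open>Arithmetic of the parameters\<close>

text \<open>\<open>H_params\<close> restricts only the exponent of \<open>M\<close>. By Cauchy's
  theorem a prime dividing \<open>order M\<close> is the order of an element and hence divides the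
  exponent.\<close>

lemma H_params_coprime:
  assumes "H_params e M r s l"
  shows "coprime (2 ^ r * 3 ^ s) (order M)"
proof -
  interpret M: comm_group M using assms by (simp add: H_params_def)
  have fin: "finite (carrier M)" using assms by (simp add: H_params_def)
  have *: "coprime p (order M)" if p: "prime p" "\<not> p dvd group_exponent M" for p
  proof (rule ccontr)
    assume "\<not> coprime p (order M)"
    then obtain x where "x \<in> carrier M" "M.ord x = p"
      using exists_ord_prime[OF M.is_group fin p(1)] prime_imp_coprime[OF p(1)] by blast
    thus False using p(2) group_exponent_pow(2)[OF M.is_group fin] M.pow_eq_id by metis
  qed
  have "\<not> p dvd group_exponent M" if "gcd (group_exponent M) 6 = 1" "p dvd 6" "p \<noteq> 1" for p
    using that by (metis gcd_greatest nat_dvd_1_iff_1)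
  from this[of 2] this[of 3]
  have "r = 0 \<or> odd (group_exponent M)" "s = 0 \<or> \<not> 3 dvd group_exponent M"
    using assms by (auto simp: H_params_def Let_def)
  thus ?thesis using *[of 2] *[of 3] by auto
qed

text \<open>\<open>2 ^ r * 3 ^ s\<close> is a multiple of \<open>e\<close> with the same prime
  divisors. Either they are equal, or a spare prime \<open>p\<close> can be split off so that
  \<open>e\<close> still divides the cofactor \<open>q\<close>; then \<open>z^q\<close> centralises
  \<open>M\<close>.\<close>

lemma H_params_cases:
  assumes "H_params e M r s l"
  obtains "2 ^ r * 3 ^ s = e" "e \<in> {2, 3, 4, 6}"
  | p q where "p \<in> {2, 3}" "2 ^ r * 3 ^ s = p * q" "[l ^ q = 1] (mod group_exponent M)"
proof -
  have e: "[l ^ e = 1] (mod group_exponent M)"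
    using assms ord[of l "group_exponent M"] by (auto simp: H_params_def Let_def)
  have cong: "[l ^ q = 1] (mod group_exponent M)" if q: "e dvd q" for q
  proof -
    obtain t where "q = e * t" using q ..
    thus ?thesis using cong_pow[OF e, of t] by (simp add: power_mult)
  qed
  consider "e = 2" "r \<ge> 1" "s = 0" | "e = 3" "r = 0" "s \<ge> 1" | "e = 4" "r \<ge> 2" "s = 0"
    | "e = 6" "r \<ge> 1" "s \<ge> 1"
    using assms by (auto simp: H_params_def Let_def)
  thus ?thesis
  proof cases
    case 1
    show ?thesis
    proof (cases "r = 1")
      case False
      hence "2 \<le> r" using 1 by simp
      then obtain t where "r = 2 + t" using le_Suc_ex by blast
      \<comment> \<open>Here and below the witness for \<open>q\<close> is written with
        \<open>e\<close> as a visible factor.\<close>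
      with 1 show ?thesis by (intro that(2)[of 2 "2 * 2 ^ t"] cong) (auto simp: power_add)
    qed (use 1 that(1) in auto)
  next
    case 2
    show ?thesis
    proof (cases "s = 1")
      case False
      hence "2 \<le> s" using 2 by simp
      then obtain t where "s = 2 + t" using le_Suc_ex by blast
      with 2 show ?thesis by (intro that(2)[of 3 "3 * 3 ^ t"] cong) (auto simp: power_add)
    qed (use 2 that(1) in auto)
  next
    case 3
    show ?thesis
    proof (cases "r = 2")
      case False
      hence "3 \<le> r" using 3 by simp
      then obtain t where "r = 3 + t" using le_Suc_ex by blast
      with 3 show ?thesis by (intro that(2)[of 2 "4 * 2 ^ t"] cong) (auto simp: power_add)
    qed (use 3 that(1) in auto)
  next
    case 4
    then obtain t u where tu: "r = 1 + t" "s = 1 + u"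
      using le_Suc_ex by meson
    consider "t = 0" "u = 0" | v where "t = Suc v" | v where "u = Suc v"
      by (cases t; cases u) auto
    thus ?thesis
    proof cases
      case 1 with 4 tu show ?thesis by (intro that(1)) auto
    next
      case 2 with 4 tu show ?thesis by (intro that(2)[of 2 "6 * (2 ^ v * 3 ^ u)"] cong) auto
    next
      case 3 with 4 tu show ?thesis by (intro that(2)[of 3 "6 * (2 ^ t * 3 ^ v)"] cong) auto
    qed
  qed
qed

text \<open>The library's \<open>DirProd_assoc\<close> is an instance of reflexivity, since \<open>\<times>\<times>\<close> associates to the right.\<close>

lemma DirProd_assoc_iso: "G \<times>\<times> (H \<times>\<times> K) \<cong> (G \<times>\<times> H) \<times>\<times> K"
proof -
  have "(\<lambda>(x, y, z). ((x, y), z)) \<in> iso (G \<times>\<times> (H \<times>\<times> K)) ((G \<times>\<times> H) \<times>\<times> K)"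
    by (auto simp: iso_def hom_def bij_betw_def inj_on_def image_iff)
  thus ?thesis by (rule is_isoI)
qed

section \<open>The contradiction\<close>

text \<open>\<open>W\<close> absorbs every other coprime factor, so both cases of the theorem become
  instances.\<close>

lemma not_k_if_H_group_factor:
  assumes G: "group G" "finite (carrier G)" "CI_group G"
    and W: "group W" "finite (carrier W)"
    and Hp: "H_params e M r s l" and iso: "G \<cong> W \<times>\<times> H_group M (2 ^ r * 3 ^ s) l"
    and cop: "coprime (order W) (order (H_group M (2 ^ r * 3 ^ s) l))"
    and k: "k \<ge> 2"
  shows "\<not> k_if_property G k"
proof
  assume kif: "k_if_property G k"
  define n :: nat where "n = 2 ^ r * 3 ^ s"
  have "comm_group M" "finite (carrier M)" using Hp by (simp_all add: H_params_def)
  then interpret coprime_H_group M n l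
    using group_H_group[OF Hp] H_params_coprime[OF Hp]
    by (intro coprime_H_group.intro) (simp_all add: n_def)
  note dvd = k_if_card_ord_class_factor[OF G kif W H.is_group iso[folded n_def] cop[folded n_def]]
  from Hp show False
  proof (cases rule: H_params_cases)
    case 1
    hence e: "n \<in> {2, 3, 4, 6}" by (simp add: n_def)
    have M0: "0 < order M" using M(2) M.order_gt_0_iff_finite by simp
    have "k dvd order M - 1"
      using dvd(1)[of "{d. d dvd order M \<and> d \<noteq> 1}"] by (simp add: card_ord_dvd_order[simplified] order_H)
    moreover have "k dvd order M"
    proof -
      let ?A = "{d. d dvd n * order M \<and> (\<forall>c\<in>{0<..<n}. \<not> d dvd c * order M)}"
      let ?I = "{i \<in> {0..<int n}. \<forall>c\<in>{0<..<n}. \<not> int n dvd int c * i}"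
      have 1: "1 \<notin> ?A" using e by auto
      have 2: "2 \<notin> ?A" if "n \<noteq> 2"
      proof -
        \<comment> \<open>For \<open>n > 2\<close> the choice \<open>c = 2\<close> is available, and
          2 divides \<open>2 * order M\<close>.\<close>
        have "2 \<in> {0<..<n}" using e that by auto
        thus ?thesis by (auto intro: bexI[of _ 2])
      qed
      have nat: "{0<..<2::nat} = {1}" "{0<..<3::nat} = {1, 2}" "{0<..<4::nat} = {1, 2, 3}"
          "{0<..<6::nat} = {1, 2, 3, 4, 5}"
        by auto
      have int: "{0..<2::int} = {0, 1}" "{0..<3::int} = {0, 1, 2}" "{0..<4::int} = {0, 1, 2, 3}"
          "{0..<6::int} = {0, 1, 2, 3, 4, 5}"
        by auto
      \<comment> \<open>For these \<open>n\<close> the only units modulo \<open>n\<close> are 1 and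
        -1, which coincide when \<open>n = 2\<close>.\<close>
      have "?I = {1, int n - 1}"
        using e
      proof (elim insertE emptyE)
        assume [simp]: "n = 2" show ?thesis by (auto simp: nat int)
      next
        assume [simp]: "n = 3" show ?thesis by (auto simp: nat int)
      next
        assume [simp]: "n = 4" show ?thesis by (auto simp: nat int)
      next
        assume [simp]: "n = 6" show ?thesis by (auto simp: nat int)
      qed
      hence card: "card {h \<in> carrier K. H.ord h \<in> ?A} = card {1, int n - 1} * order M"
        using card_ord_outside by simp
      have A: "d dvd order K" if "d \<in> ?A" for d using that unfolding order_H by blast
      show ?thesis
      \<comment> \<open>For \<open>n = 2\<close> the class contains the involution \<open>z\<close>,
        so only \<open>k\<close> is known to divide its size, but that size is already
        \<open>order M\<close>. Otherwise \<open>2 * k\<close> divides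
        \<open>2 * order M\<close>.\<close>
      proof (cases "n = 2")
        case True
        thus ?thesis using dvd(1)[OF A 1] unfolding card by simp
      next
        case False
        hence "card {1, int n - 1} = 2" using e by auto
        thus ?thesis using dvd(2)[OF A 1 2[OF False]] unfolding card by simp
      qed
    qed
    ultimately have "k dvd 1" using M0
      by (metis Suc_diff_1 dvd_add_right_iff plus_1_eq_Suc add.commute)
    with k show False by simp
  next
    case (2 p q)
    have p: "prime p" using 2(1) by auto
    note X = card_ord_prime[OF p _ 2(3), folded n_def, OF 2(2)[folded n_def]]
    have A: "d dvd order K" if "d \<in> {p}" for d
      using that 2(2)[folded n_def] unfolding order_H by simp
    \<comment> \<open>There are between 1 and \<open>p - 1\<close> elements of order
      \<open>p\<close>: exactly one for \<open>p = 2\<close>, too few for \<open>k \<ge> 2\<close>,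
      and at most two for \<open>p = 3\<close>, too few for \<open>2 * k \<ge> 4\<close>.\<close>
    show False
    proof (cases "p = 2")
      case True
      hence "k dvd card {h \<in> carrier K. H.ord h \<in> {p}}" using dvd(1)[OF A, of "{p}"] by simp
      with X k show False using True by (auto dest!: dvd_imp_le)
    next
      case False
      hence "p = 3" using 2(1) by simp
      hence "2 * k dvd card {h \<in> carrier K. H.ord h \<in> {p}}" using dvd(2)[OF A, of "{p}"] by simp
      with X k show False using \<open>p = 3\<close> by (auto dest!: dvd_imp_le)
    qed
  qed
qed

theorem theorem4p7:
  fixes G :: "'g monoid" and U :: "'u monoid" and V :: "'v monoid" and k :: nat
  assumes G: "group G" "finite (carrier G)" "CI_group G"
    and U: "comm_group U"
    and V: "group V"
    and GUV: "G \<cong> U \<times>\<times> V"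
    and cop: "coprime (order U) (order V)"
    and cases:
      "(\<exists>e (M :: 'm monoid) r s l.
          H_params e M r s l \<and> r + s \<ge> 1 \<and> V \<cong> H_group M (2 ^ r * 3 ^ s) l)
       \<or>
       (\<exists>(M :: 'm1 monoid) (M' :: 'm2 monoid) r s l l'.
          H_params 2 M r 0 l \<and> H_params 3 M' 0 s l' \<and>
          coprime (order M) 2 \<and> coprime (order M) (order M') \<and> coprime (order M) 3 \<and>
          coprime 2 (order M') \<and> coprime (order M') 3 \<and>
          1 \<le> r \<and> r \<le> 3 \<and> 1 \<le> s \<and> s \<le> 2 \<and> l > 1 \<and> l' > 1 \<and>
          V \<cong> H_group M (2 ^ r) l \<times>\<times> H_group M' (3 ^ s) l')"
    and k: "k \<ge> 2"
  shows "\<not> k_if_property G k"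
proof -
  interpret U: comm_group U by fact
  interpret V: group V by fact
  have "finite (carrier U \<times> carrier V)" using iso_finite[OF GUV] G(2) by simp
  hence finU: "finite (carrier U)"
    using V.one_closed by (auto simp: finite_cartesian_product_iff)
  \<comment> \<open>Stated for arbitrary \<open>X\<close> to serve both shapes of
    \<open>V\<close>.\<close>
  have GUX: "G \<cong> U \<times>\<times> X" if "V \<cong> X" for X :: "('x, 'y) monoid_scheme"
    using iso_trans[OF GUV U.DirProd_iso_trans[OF iso_refl that]] .
  from cases show ?thesis
  proof (elim disjE exE conjE)
    fix e r s l and M :: "'m monoid"
    assume H: "H_params e M r s l" and iso: "V \<cong> H_group M (2 ^ r * 3 ^ s) l"
    have "order V = order (H_group M (2 ^ r * 3 ^ s) l)"
      using iso_same_card[OF iso] by (simp add: order_def)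
    thus ?thesis
      using not_k_if_H_group_factor[OF G U.is_group finU H GUX[OF iso] _ k] cop by simp
  next
    fix r s l l' and M :: "'m1 monoid" and M' :: "'m2 monoid"
    assume H: "H_params 2 M r 0 l" and H': "H_params 3 M' 0 s l'"
      and cops: "coprime (order M) 2" "coprime (order M) (order M')" "coprime (order M) 3"
        "coprime 2 (order M')"
      and iso: "V \<cong> H_group M (2 ^ r) l \<times>\<times> H_group M' (3 ^ s) l'"
    \<comment> \<open>The trivial powers keep the form \<open>2 ^ r * 3 ^ s\<close> of the general
      lemmas.\<close>
    let ?H = "H_group M (2 ^ r * 3 ^ 0) l" and ?K = "H_group M' (2 ^ 0 * 3 ^ s) l'"
    have grp: "group ?H" "group ?K" using group_H_group[OF H] group_H_group[OF H'] by auto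
    have ord: "order ?H = 2 ^ r * order M" "order ?K = 3 ^ s * order M'"
      by (simp_all add: order_def H_group_def carrier_integer_mod_group card_cartesian_product)
    have fin: "finite (carrier (U \<times>\<times> ?K))"
      using finU H' by (simp add: H_group_def carrier_integer_mod_group H_params_def)
    have W: "group (U \<times>\<times> ?K)" using grp by (simp add: DirProd_group)
    have iso': "V \<cong> ?H \<times>\<times> ?K" using iso by simp
    \<comment> \<open>Swapping and reassociating leaves the type 2 factor last, with
      \<open>U \<times>\<times> ?K\<close> in the role of \<open>W\<close>.\<close>
    hence "V \<cong> ?K \<times>\<times> ?H" using iso_trans DirProd_commute_iso by blast
    hence "G \<cong> U \<times>\<times> (?K \<times>\<times> ?H)" by (rule GUX)
    hence isoG: "G \<cong> (U \<times>\<times> ?K) \<times>\<times> ?H" by (rule iso_trans[OF _ DirProd_assoc_iso])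
    have "order V = order ?H * order ?K"
      using iso_same_card[OF iso'] by (simp only: order_def carrier_DirProd card_cartesian_product)
    moreover have "coprime (order ?K) (order ?H)"
      unfolding ord using cops cops[THEN coprime_commute[THEN iffD1]] by simp
    ultimately have "coprime (order (U \<times>\<times> ?K)) (order ?H)"
      using cop by (simp add: order_def card_cartesian_product del: power_0)
    thus ?thesis by (rule not_k_if_H_group_factor[OF G W fin H isoG _ k])
  qed
qed

end
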